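(* Let $X$ be a reflexive normed space, let $\mathcal{I}$ be an ideal on $\mathbb{N}$, and let $\{\omega_t\}_{t\in\mathbb{N}}$ be a weighted sequence. For any sequence $x=\{x_t\}_{t\in\mathbb{N}}$ in $X$ with $\tilde r(x)<\infty$, one has $(\omega_t,\mathcal{I})\text{-}\mathrm{LIM}^{\tilde r(x)} x_t\neq\varnothing$.
   Context: A sequence $\{\omega_t\}_{t\in\mathbb{N}}$ of real numbers is a weighted sequence if there is $\beta>0$ with $\omega_t>\beta$ for all $t\in\mathbb{N}$. An ideal on $\mathbb{N}$ is a family $\mathcal{I}\subseteq\mathcal{P}(\mathbb{N})$ with $\varnothing\in\mathcal{I}$, closed under finite unions and under taking subsets. For a real $r\ge0$, $(\omega_t,\mathcal{I})\text{-}\mathrm{LIM}^r x_t$ is the set of all $x_*\in X$ such that $\{t\in\mathbb{N}:\omega_t\|x_t-x_*\|>r+\varepsilon\}\in\mathcal{I}$ for every $\varepsilon>0$. The minimal weighted ideal convergent degree of $x$ is $\tilde r(x)=\tilde r_{(\omega_t,\mathcal{I})}(x):=\inf\{r\in(0,\infty):(\omega_t,\mathcal{I})\text{-}\mathrm{LIM}^r x_t\ne\varnothing\}$ (with $\inf\varnothing=\infty$). $X$ is reflexive if the canonical embedding $X\to X^{**}$ is surjective. *)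

theory Defs
  imports "HOL-Analysis.Analysis"
begin

text \<open>Normed spaces are real normed spaces, with continuous dual \<open>'a \<Rightarrow>\<^sub>L real\<close>.\<close>

definition canonical_embedding ::
    "'a::real_normed_vector \<Rightarrow> (('a \<Rightarrow>\<^sub>L real) \<Rightarrow>\<^sub>L real)" where
  "canonical_embedding v = Blinfun (\<lambda>f. blinfun_apply f v)"

lemma canonical_embedding_apply [simp]:
  "blinfun_apply (canonical_embedding v) f = blinfun_apply f v"
  unfolding canonical_embedding_def
  by (simp add: bounded_linear_Blinfun_apply blinfun.bounded_linear_left)

definition reflexive_space :: "'a::real_normed_vector itself \<Rightarrow> bool" where
  "reflexive_space _ \<longleftrightarrow>
     surj (canonical_embedding :: 'a \<Rightarrow> (('a \<Rightarrow>\<^sub>L real) \<Rightarrow>\<^sub>L real))"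

definition weighted_sequence :: "(nat \<Rightarrow> real) \<Rightarrow> bool" where
  "weighted_sequence \<omega> \<longleftrightarrow> (\<exists>\<beta>>0. \<forall>t. \<omega> t > \<beta>)"

text \<open>An ideal need be neither proper nor contain the finite sets.\<close>

definition ideal_on_nat :: "nat set set \<Rightarrow> bool" where
  "ideal_on_nat \<I> \<longleftrightarrow>
     {} \<in> \<I> \<and> (\<forall>A\<in>\<I>. \<forall>B\<in>\<I>. A \<union> B \<in> \<I>) \<and> (\<forall>A\<in>\<I>. \<forall>B. B \<subseteq> A \<longrightarrow> B \<in> \<I>)"

definition weighted_ideal_LIM ::
    "(nat \<Rightarrow> real) \<Rightarrow> nat set set \<Rightarrow> real \<Rightarrow> (nat \<Rightarrow> 'a::real_normed_vector) \<Rightarrow> 'a set" where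
  "weighted_ideal_LIM \<omega> \<I> r x =
     {l. \<forall>\<epsilon>>0. {t. \<omega> t * norm (x t - l) > r + \<epsilon>} \<in> \<I>}"

text \<open>The infimum is taken in the extended reals, so that it is \<open>\<infinity>\<close> over the empty set.\<close>

definition min_weighted_ideal_degree ::
    "(nat \<Rightarrow> real) \<Rightarrow> nat set set \<Rightarrow> (nat \<Rightarrow> 'a::real_normed_vector) \<Rightarrow> ereal" where
  "min_weighted_ideal_degree \<omega> \<I> x =
     Inf (ereal ` {r. r > 0 \<and> weighted_ideal_LIM \<omega> \<I> r x \<noteq> {}})"

text \<open>As an infimum of positive numbers the degree is never \<open>-\<infinity>\<close>; hence \<open>real_of_ereal\<close>
  does not change its value whenever it is less than \<open>\<infinity>\<close>.\<close>

lemma min_weighted_ideal_degree_nonneg: "min_weighted_ideal_degree \<omega> \<I> x \<ge> 0"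
  unfolding min_weighted_ideal_degree_def by (rule Inf_greatest) auto

end

theory Submission
  imports Defs
begin

text \<open>
  If the ideal contains \<open>\<nat>\<close>, every point is a limit. Otherwise the sets \<open>LIM\<^sup>s\<close> with \<open>s > r\<close>, where \<open>r\<close> is the
  degree, are nonempty and decrease as \<open>s\<close> decreases to \<open>r\<close>; they are convex and closed, and they
  are bounded because the weights are bounded away from \<open>0\<close>. Their intersection is \<open>LIM\<^sup>r\<close>. The
  theorem is therefore an instance of Smulian's property: in a reflexive space a decreasing
  sequence of nonempty bounded closed convex sets has a common point
  (\<open>reflexive_nested_convex_nonempty\<close>).

  Closedness is the point at which the weights could cause trouble, since
  \<open>\<omega> t * norm (x t - l)\<close> need not be equicontinuous in \<open>l\<close>. Either the weights are bounded outside a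
  set of the ideal, and the usual \<open>\<epsilon>/2\<close> argument works, or arbitrarily large weights occur on sets
  outside the ideal, and then two limit points must coincide (\<open>closed_weighted_ideal_LIM\<close>).

  Smulian's property is derived from the following form of the Hahn--Banach theorem: every
  sublinear functional dominates a linear one (\<open>sublinear_dominates_linear\<close>). It is used twice.
  On the dual space, the limit of the support functions of the sets is sublinear; a linear
  functional below it is bounded, so by reflexivity it is evaluation at some point \<open>y\<close>. On the space
  itself, the same theorem separates a point from a closed convex set, which shows that \<open>y\<close> lies in
  all the sets, since \<open>f y\<close> never exceeds the supremum of \<open>f\<close> over any of them.
\<close>

section \<open>Sublinear functionals and the Hahn--Banach theorem\<close>

text \<open>
  Homogeneity is required only as an inequality, which is what constructions by infima give
  directly; \<open>sublinear_scale\<close> recovers the equality.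
\<close>

definition sublinear :: "('v::real_vector \<Rightarrow> real) \<Rightarrow> bool" where
  "sublinear p \<longleftrightarrow>
     (\<forall>v w. p (v + w) \<le> p v + p w) \<and> (\<forall>c\<ge>0. \<forall>v. p (c *\<^sub>R v) \<le> c * p v)"

lemma sublinear_add: "sublinear p \<Longrightarrow> p (v + w) \<le> p v + p w"
  and sublinear_scale_le: "sublinear p \<Longrightarrow> 0 \<le> c \<Longrightarrow> p (c *\<^sub>R v) \<le> c * p v"
  by (auto simp: sublinear_def)

lemma sublinear_zero:
  assumes "sublinear p"
  shows "p 0 = 0"
  using sublinear_add[OF assms, of 0 0] sublinear_scale_le[OF assms, of 0 0] by simp

lemma sublinear_scale:
  assumes "sublinear p" and "0 \<le> c"
  shows "p (c *\<^sub>R v) = c * p v"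
proof (cases "c = 0")
  case False
  then have "c > 0" using assms(2) by simp
  then have "p v \<le> inverse c * p (c *\<^sub>R v)"
    using sublinear_scale_le[OF assms(1), of "inverse c" "c *\<^sub>R v"] by simp
  then have "c * p v \<le> p (c *\<^sub>R v)"
    using \<open>c > 0\<close> by (simp add: field_simps)
  then show ?thesis
    using sublinear_scale_le[OF assms, of v] by simp
qed (simp add: sublinear_zero[OF assms(1)])

lemma sublinear_lower:
  assumes "sublinear p"
  shows "- p (- v) \<le> p v"
  using sublinear_add[OF assms, of v "- v"] sublinear_zero[OF assms] by simp

text \<open>
  The sublinear functionals constructed below are pointwise infima. The members of the family need not be
  sublinear themselves: it suffices that the two inequalities hold after a change of index.
\<close>

lemma sublinear_INF:
  fixes g :: "'i \<Rightarrow> 'v::real_vector \<Rightarrow> real"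
  assumes ne: "A \<noteq> {}"
    and bdd: "\<And>v. bdd_below ((\<lambda>i. g i v) ` A)"
    and add: "\<And>i j v w. i \<in> A \<Longrightarrow> j \<in> A \<Longrightarrow> \<exists>k\<in>A. g k (v + w) \<le> g i v + g j w"
    and scale: "\<And>i c v. i \<in> A \<Longrightarrow> 0 \<le> c \<Longrightarrow> \<exists>k\<in>A. g k (c *\<^sub>R v) \<le> c * g i v"
  shows "sublinear (\<lambda>v. INF i\<in>A. g i v)"
  unfolding sublinear_def
proof (intro conjI allI impI)
  let ?q = "\<lambda>v. INF i\<in>A. g i v"
  have low: "?q v \<le> g i v" if "i \<in> A" for i v
    using bdd that by (rule cINF_lower)
  fix v w
  have "?q (v + w) - g j w \<le> g i v" if ij: "i \<in> A" "j \<in> A" for i j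
  proof -
    obtain k where "k \<in> A" "g k (v + w) \<le> g i v + g j w"
      using add[OF ij] by blast
    then show ?thesis using low[of k "v + w"] by linarith
  qed
  then have "?q (v + w) - g j w \<le> ?q v" if "j \<in> A" for j
    using that by (intro cINF_greatest ne) auto
  then have "?q (v + w) - ?q v \<le> g j w" if "j \<in> A" for j
    using that by (simp add: algebra_simps)
  then have "?q (v + w) - ?q v \<le> ?q w"
    by (intro cINF_greatest ne) auto
  then show "?q (v + w) \<le> ?q v + ?q w" by linarith
next
  let ?q = "\<lambda>v. INF i\<in>A. g i v"
  have low: "?q v \<le> g i v" if "i \<in> A" for i v
    using bdd that by (rule cINF_lower)
  fix c :: real and v
  assume c: "0 \<le> c"
  have le: "?q (c *\<^sub>R v) \<le> c * g i v" if i: "i \<in> A" for i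
  proof -
    obtain k where "k \<in> A" "g k (c *\<^sub>R v) \<le> c * g i v"
      using scale[OF i c] by blast
    then show ?thesis using low[of k "c *\<^sub>R v"] by linarith
  qed
  show "?q (c *\<^sub>R v) \<le> c * ?q v"
  proof (cases "c = 0")
    case True
    then show ?thesis using le ne by auto
  next
    case False
    then have "c > 0" using c by simp
    then have "?q (c *\<^sub>R v) / c \<le> g i v" if "i \<in> A" for i
      using le[OF that] by (simp add: field_simps)
    then have "?q (c *\<^sub>R v) / c \<le> ?q v"
      by (intro cINF_greatest ne) auto
    then show ?thesis using \<open>c > 0\<close> by (simp add: field_simps)
  qed
qed

text \<open>
  Zorn's lemma applies because the infimum of a chain of sublinear functionals is sublinear; it is
  finite because a sublinear functional below \<open>p\<close> is above \<open>\<lambda>v. - p (- v)\<close>.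
\<close>

lemma minimal_sublinear_exists:
  fixes p :: "'v::real_vector \<Rightarrow> real"
  assumes p: "sublinear p"
  obtains q where "sublinear q" "q \<le> p" "\<And>q'. sublinear q' \<Longrightarrow> q' \<le> q \<Longrightarrow> q' = q"
proof -
  define S where "S = {q. sublinear q \<and> q \<le> p}"
  let ?R = "\<lambda>q q' :: 'v \<Rightarrow> real. q' \<le> q"
  have "\<exists>m\<in>S. \<forall>a\<in>S. ?R m a \<longrightarrow> a = m"
  proof (rule predicate_Zorn)
    show "partial_order_on S (relation_of ?R S)"
      by (rule partial_order_on_relation_ofI) auto
    fix C
    assume "C \<in> Chains (relation_of ?R S)"
    then have CS: "C \<subseteq> S" and chain: "\<And>q q'. q \<in> C \<Longrightarrow> q' \<in> C \<Longrightarrow> q' \<le> q \<or> q \<le> q'"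
      by (auto simp: Chains_def relation_of_def)
    show "\<exists>u\<in>S. \<forall>a\<in>C. ?R a u"
    proof (cases "C = {}")
      case True
      then show ?thesis using p by (auto simp: S_def)
    next
      case False
      have bdd: "bdd_below ((\<lambda>q. q v) ` C)" for v
      proof (rule bdd_belowI2)
        fix q assume "q \<in> C"
        then have "sublinear q" "q (- v) \<le> p (- v)"
          using CS by (auto simp: S_def le_fun_def)
        then show "- p (- v) \<le> q v"
          using sublinear_lower[of q v] by linarith
      qed
      let ?u = "\<lambda>v. INF q\<in>C. q v"
      have low: "?u v \<le> q v" if "q \<in> C" for q v
        using bdd that by (rule cINF_lower)
      have "sublinear ?u"
      proof (rule sublinear_INF[OF False bdd])
        fix q q' v w
        assume q: "q \<in> C" "q' \<in> C"
        define m where "m = (if q' \<le> q then q' else q)"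
        have "m \<in> C" "m \<le> q" "m \<le> q'"
          using q chain[OF q] by (auto simp: m_def)
        moreover have "m (v + w) \<le> m v + m w"
          using \<open>m \<in> C\<close> CS by (auto simp: S_def intro: sublinear_add)
        ultimately have "m (v + w) \<le> q v + q' w"
          by (meson add_mono le_funD order_trans)
        then show "\<exists>k\<in>C. k (v + w) \<le> q v + q' w"
          using \<open>m \<in> C\<close> by blast
      next
        fix q c v
        assume "q \<in> C" "(0::real) \<le> c"
        then show "\<exists>k\<in>C. k (c *\<^sub>R v) \<le> c * q v"
          using CS by (intro bexI[of _ q]) (auto simp: S_def intro: sublinear_scale_le)
      qed
      moreover have "?u \<le> p"
      proof -
        obtain q where "q \<in> C" using False by blast
        then have "?u v \<le> p v" for v
          using low[of q v] CS by (auto simp: S_def le_fun_def intro: order_trans)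
        then show ?thesis by (simp add: le_fun_def)
      qed
      ultimately show ?thesis
        using low by (intro bexI[of _ ?u]) (auto simp: S_def le_fun_def)
    qed
  qed
  then obtain q where "q \<in> S" "\<And>a. a \<in> S \<Longrightarrow> a \<le> q \<Longrightarrow> a = q" by blast
  then show thesis
    by (intro that[of q]) (auto simp: S_def intro: order_trans)
qed

text \<open>
  A minimal sublinear functional \<open>q\<close> is linear: pushing \<open>q\<close> down along a direction \<open>w\<close> gives the
  sublinear functional \<open>\<lambda>v. INF c\<in>{0..}. q (v + c w) - c q w\<close>, which by minimality equals \<open>q\<close>, and
  its term for \<open>c = 1\<close> gives the superadditivity of \<open>q\<close>.
\<close>

theorem sublinear_dominates_linear:
  fixes p :: "'v::real_vector \<Rightarrow> real"
  assumes "sublinear p"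
  obtains L where "linear L" "\<And>v. L v \<le> p v"
proof -
  obtain q where q: "sublinear q" and qp: "q \<le> p"
    and min: "\<And>q'. sublinear q' \<Longrightarrow> q' \<le> q \<Longrightarrow> q' = q"
    using minimal_sublinear_exists[OF assms] by blast
  have super: "q v + q w \<le> q (v + w)" for v w
  proof -
    let ?g = "\<lambda>c v. q (v + c *\<^sub>R w) - c * q w"
    let ?q' = "\<lambda>v. INF c\<in>{0::real..}. ?g c v"
    have bdd: "bdd_below ((\<lambda>c. ?g c v) ` {0..})" for v
    proof (rule bdd_belowI2)
      fix c :: real assume "c \<in> {0..}"
      then show "- q (- v) \<le> ?g c v"
        using sublinear_add[OF q, of "v + c *\<^sub>R w" "- v"] sublinear_scale[OF q, of c w]
        by simp
    qed
    have low: "?q' v \<le> ?g c v" if "c \<ge> 0" for c v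
      using bdd that by (intro cINF_lower) auto
    have "sublinear ?q'"
    proof (rule sublinear_INF[OF _ bdd])
      fix i j :: real and u v
      assume "i \<in> {0..}" "j \<in> {0..}"
      moreover have "?g (i + j) (u + v) \<le> ?g i u + ?g j v"
        using sublinear_add[OF q, of "u + i *\<^sub>R w" "v + j *\<^sub>R w"]
        by (simp add: algebra_simps)
      ultimately show "\<exists>k\<in>{0..}. ?g k (u + v) \<le> ?g i u + ?g j v"
        by (intro bexI[of _ "i + j"]) auto
    next
      fix i c :: real and v
      assume "i \<in> {0..}" "0 \<le> c"
      moreover have "?g (c * i) (c *\<^sub>R v) \<le> c * ?g i v"
        using sublinear_scale_le[OF q \<open>0 \<le> c\<close>, of "v + i *\<^sub>R w"]
        by (simp add: algebra_simps)
      ultimately show "\<exists>k\<in>{0..}. ?g k (c *\<^sub>R v) \<le> c * ?g i v"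
        by (intro bexI[of _ "c * i"]) auto
    qed simp
    moreover have "?q' \<le> q"
      using low[of 0] by (auto simp: le_fun_def)
    ultimately have "?q' = q" by (rule min)
    from fun_cong[OF sym[OF this]] have "q v = ?q' v" .
    also have "\<dots> \<le> ?g 1 v" by (rule low) simp
    finally have "q v \<le> ?g 1 v" .
    then show ?thesis by simp
  qed
  then have add: "q (v + w) = q v + q w" for v w
    using sublinear_add[OF q, of v w] super[of v w] by simp
  have neg: "q (- v) = - q v" for v
    using add[of v "- v"] sublinear_zero[OF q] by simp
  have scale: "q (c *\<^sub>R v) = c *\<^sub>R q v" for c v
  proof (cases "c \<ge> 0")
    case True
    then show ?thesis using sublinear_scale[OF q] by simp
  next
    case False
    then have "q ((- c) *\<^sub>R v) = - c * q v"
      using sublinear_scale[OF q, of "- c" v] by simp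
    then show ?thesis using neg[of "c *\<^sub>R v"] by simp
  qed
  have "linear q"
    by (rule linearI) (use add scale in auto)
  moreover have "q v \<le> p v" for v
    using qp by (simp add: le_fun_def)
  ultimately show thesis by (rule that)
qed

lemma linear_bounded_above_imp_bounded_linear:
  fixes L :: "'v::real_normed_vector \<Rightarrow> real"
  assumes "linear L" and le: "\<And>v. L v \<le> B * norm v"
  shows "bounded_linear L"
proof (rule bounded_linear_intro)
  fix v
  show "norm (L v) \<le> norm v * B"
    using le[of v] le[of "- v"] linear_neg[OF assms(1), of v] by (simp add: abs_le_iff mult.commute)
qed (use assms(1) in \<open>auto simp: linear_add linear_scale\<close>)

section \<open>Nested convex sets in reflexive spaces\<close>

text \<open>
  Let \<open>d > 0\<close> be a lower bound for the distances from \<open>y\<close> to the points of \<open>C\<close>. The functional \<open>INF s c. norm (v - s (c - y)) - s d\<close> over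
  \<open>s \<ge> 0\<close> and \<open>c \<in> C\<close> is subadditive by convexity of \<open>C\<close> and lies between \<open>- norm\<close> and \<open>norm\<close>. Its
  value at \<open>c - y\<close> is at most \<open>- d\<close>, and so is the value of any linear functional below it.
\<close>

lemma separation_point_closed_convex:
  fixes C :: "'a::real_normed_vector set"
  assumes C: "convex C" "closed C" and y: "y \<notin> C"
  obtains f :: "'a \<Rightarrow>\<^sub>L real" and d where "d > 0" "\<And>c. c \<in> C \<Longrightarrow> blinfun_apply f c \<le> blinfun_apply f y - d"
proof (cases "C = {}")
  case True
  then show ?thesis using that[of 1 0] by simp
next
  case False
  obtain d where d: "d > 0" "\<And>c. c \<in> C \<Longrightarrow> d \<le> norm (c - y)"
  proof -
    obtain d where "d > 0" "ball y d \<subseteq> - C"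
      using C(2) y by (metis Compl_iff closed_def open_contains_ball)
    then show ?thesis
      by (intro that[of d]) (force simp: subset_iff dist_norm norm_minus_commute not_less[symmetric])+
  qed
  define A where "A = {0::real..} \<times> C"
  define g where "g = (\<lambda>(s, c) v. norm (v - s *\<^sub>R (c - y)) - s * d)"
  let ?p = "\<lambda>v. INF i\<in>A. g i v"
  have bdd: "bdd_below ((\<lambda>i. g i v) ` A)" for v
  proof (rule bdd_belowI2)
    fix i assume "i \<in> A"
    then obtain s c where i: "i = (s, c)" "s \<ge> 0" "c \<in> C" by (auto simp: A_def)
    have "s * d \<le> norm (s *\<^sub>R (c - y))"
      using i d by (simp add: mult_left_mono)
    also have "\<dots> \<le> norm (v - s *\<^sub>R (c - y)) + norm v"
      by (metis norm_minus_commute norm_triangle_sub add.commute)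
    finally show "- norm v \<le> g i v" by (simp add: g_def i)
  qed
  have low: "?p v \<le> norm (v - s *\<^sub>R (c - y)) - s * d" if "s \<ge> 0" "c \<in> C" for s c v
  proof -
    have "(s, c) \<in> A" using that by (simp add: A_def)
    then have "?p v \<le> g (s, c) v" by (rule cINF_lower[OF bdd])
    then show ?thesis by (simp add: g_def)
  qed
  have "sublinear ?p"
  proof (rule sublinear_INF[OF _ bdd])
    show "A \<noteq> {}" using False by (auto simp: A_def)
  next
    fix i j v w
    assume "i \<in> A" "j \<in> A"
    then obtain s c t e where ij: "i = (s, c)" "j = (t, e)" and
      st: "s \<ge> 0" "t \<ge> 0" "c \<in> C" "e \<in> C" by (auto simp: A_def)
    obtain k where k: "k \<in> C" "(s + t) *\<^sub>R (k - y) = s *\<^sub>R (c - y) + t *\<^sub>R (e - y)"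
    proof (cases "s + t = 0")
      case True
      then have "s = 0" "t = 0" using st by auto
      then show ?thesis using that[of c] st by simp
    next
      case nz: False
      let ?k = "(s / (s + t)) *\<^sub>R c + (t / (s + t)) *\<^sub>R e"
      have "?k \<in> C"
        using st nz by (intro convexD[OF C(1)]) (auto simp: add_divide_distrib[symmetric])
      moreover have "(s + t) *\<^sub>R ?k = s *\<^sub>R c + t *\<^sub>R e"
        using nz by (simp add: scaleR_right_distrib)
      then have "(s + t) *\<^sub>R (?k - y) = s *\<^sub>R (c - y) + t *\<^sub>R (e - y)"
        by (simp add: scaleR_right_diff_distrib scaleR_left_distrib)
      ultimately show ?thesis by (rule that)
    qed
    have "v + w - (s + t) *\<^sub>R (k - y) = (v - s *\<^sub>R (c - y)) + (w - t *\<^sub>R (e - y))"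
      unfolding k(2) by simp
    then have "norm (v + w - (s + t) *\<^sub>R (k - y))
        \<le> norm (v - s *\<^sub>R (c - y)) + norm (w - t *\<^sub>R (e - y))"
      by (metis norm_triangle_ineq)
    then have "g (s + t, k) (v + w) \<le> g i v + g j w"
      by (simp add: g_def ij distrib_right)
    moreover have "(s + t, k) \<in> A" using st k by (simp add: A_def)
    ultimately show "\<exists>k\<in>A. g k (v + w) \<le> g i v + g j w" by blast
  next
    fix i v and a :: real
    assume "i \<in> A" "0 \<le> a"
    then obtain s c where i: "i = (s, c)" "s \<ge> 0" "c \<in> C" by (auto simp: A_def)
    have "norm (a *\<^sub>R v - (a * s) *\<^sub>R (c - y)) = norm (a *\<^sub>R (v - s *\<^sub>R (c - y)))"
      by (simp add: scaleR_right_diff_distrib)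
    also have "\<dots> = a * norm (v - s *\<^sub>R (c - y))" using \<open>0 \<le> a\<close> by simp
    finally have "g (a * s, c) (a *\<^sub>R v) \<le> a * g i v"
      by (simp add: g_def i algebra_simps)
    moreover have "(a * s, c) \<in> A" using i \<open>0 \<le> a\<close> by (simp add: A_def)
    ultimately show "\<exists>k\<in>A. g k (a *\<^sub>R v) \<le> a * g i v" by blast
  qed
  then obtain L where L: "linear L" "\<And>v. L v \<le> ?p v"
    by (rule sublinear_dominates_linear) blast
  obtain c0 where "c0 \<in> C" using False by blast
  then have "L v \<le> 1 * norm v" for v
    using L(2)[of v] low[of 0 c0 v] by simp
  with L(1) have bl: "bounded_linear L"
    by (rule linear_bounded_above_imp_bounded_linear)
  have "L c \<le> L y - d" if "c \<in> C" for c
    using L(2)[of "c - y"] low[of 1 c "c - y"] that linear_diff[OF L(1), of c y] by simp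
  then show thesis
    using that[of d "Blinfun L"] d(1) by (simp add: bounded_linear_Blinfun_apply[OF bl])
qed

text \<open>
  The limit of the decreasing sequence of support functions is sublinear on the dual space. A
  linear functional below it is, by reflexivity, evaluation at a point \<open>y\<close>, and \<open>y\<close> satisfies every
  inequality \<open>f c \<le> \<alpha>\<close>, with \<open>f\<close> in the dual, that holds for all \<open>c\<close> in one of the sets. By
  separation, \<open>y\<close> then lies in each of them.
\<close>

theorem reflexive_nested_convex_nonempty:
  fixes C :: "nat \<Rightarrow> 'a::real_normed_vector set"
  assumes refl: "reflexive_space TYPE('a)"
    and ne: "\<And>n. C n \<noteq> {}" and dec: "decseq C" and bdd0: "bounded (C 0)"
    and conv: "\<And>n. convex (C n)" and clsd: "\<And>n. closed (C n)"
  shows "(\<Inter>n. C n) \<noteq> {}"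
proof -
  obtain B where B: "\<And>c. c \<in> C 0 \<Longrightarrow> norm c \<le> B"
    using bdd0 by (auto simp: bounded_iff)
  have sub: "C n \<subseteq> C m" if "m \<le> n" for m n
    using dec that by (auto simp: decseq_def)
  have fB: "\<bar>blinfun_apply f c\<bar> \<le> B * norm f" if "c \<in> C n" for f :: "'a \<Rightarrow>\<^sub>L real" and c n
  proof -
    have "norm c \<le> B" using B sub[of 0 n] that by auto
    then have "norm f * norm c \<le> norm f * B" by (simp add: mult_left_mono)
    then show ?thesis using norm_blinfun[of f c] by (simp add: mult.commute)
  qed
  let ?h = "\<lambda>n (f :: 'a \<Rightarrow>\<^sub>L real). SUP c\<in>C n. blinfun_apply f c"
  have bda: "bdd_above (blinfun_apply f ` C n)" for f :: "'a \<Rightarrow>\<^sub>L real" and n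
    using fB[of _ n f] by (intro bdd_aboveI2[of _ _ "B * norm f"]) (auto simp: abs_le_iff)
  have up: "blinfun_apply f c \<le> ?h n f" if "c \<in> C n" for f :: "'a \<Rightarrow>\<^sub>L real" and c n
    using bda that by (intro cSUP_upper) auto
  have h_lower: "- (B * norm f) \<le> ?h n f" for n f
  proof -
    obtain c where "c \<in> C n" using ne by blast
    then show ?thesis using up[of c n f] fB[of c n f] by (simp add: abs_le_iff)
  qed
  let ?p = "\<lambda>f. INF n\<in>UNIV. ?h n f"
  have bdb: "bdd_below ((\<lambda>n. ?h n f) ` UNIV)" for f
    by (rule bdd_belowI2[of _ "- (B * norm f)"]) (rule h_lower)
  have low: "?p f \<le> ?h n f" for n f
    using bdb by (rule cINF_lower) simp
  have "sublinear ?p"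
  proof (rule sublinear_INF[OF _ bdb])
    fix m n :: nat and f g :: "'a \<Rightarrow>\<^sub>L real"
    have "?h (max m n) (f + g) \<le> ?h m f + ?h n g"
    proof (rule cSUP_least[OF ne])
      fix c assume "c \<in> C (max m n)"
      then have "c \<in> C m" "c \<in> C n" using sub[of m "max m n"] sub[of n "max m n"] by auto
      then show "blinfun_apply (f + g) c \<le> ?h m f + ?h n g"
        using up[of c m f] up[of c n g] by (simp add: blinfun.add_left)
    qed
    then show "\<exists>k\<in>UNIV. ?h k (f + g) \<le> ?h m f + ?h n g" by blast
  next
    fix n :: nat and a :: real and f :: "'a \<Rightarrow>\<^sub>L real"
    assume "0 \<le> a"
    then have "?h n (a *\<^sub>R f) \<le> a * ?h n f"
      by (intro cSUP_least[OF ne]) (simp add: blinfun.scaleR_left mult_left_mono up)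
    then show "\<exists>k\<in>UNIV. ?h k (a *\<^sub>R f) \<le> a * ?h n f" by blast
  qed simp
  then obtain L where L: "linear L" "\<And>f. L f \<le> ?p f"
    by (rule sublinear_dominates_linear) blast
  have "L f \<le> B * norm f" for f
  proof -
    have "?h 0 f \<le> B * norm f"
      using fB[of _ 0 f] by (intro cSUP_least[OF ne]) (auto simp: abs_le_iff)
    then show ?thesis using L(2)[of f] low[of f 0] by linarith
  qed
  with L(1) have bl: "bounded_linear L"
    by (rule linear_bounded_above_imp_bounded_linear)
  obtain y :: 'a where "Blinfun L = canonical_embedding y"
    using refl unfolding reflexive_space_def by (meson surjD)
  then have "L f = blinfun_apply f y" for f
    by (metis bl bounded_linear_Blinfun_apply canonical_embedding_apply)
  then have y_le: "blinfun_apply f y \<le> ?h n f" for f n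
    using L(2)[of f] low[of f n] by (metis order_trans)
  have "y \<in> C n" for n
  proof (rule ccontr)
    assume "y \<notin> C n"
    then obtain f :: "'a \<Rightarrow>\<^sub>L real" and d where d: "d > 0"
      and f: "\<And>c. c \<in> C n \<Longrightarrow> blinfun_apply f c \<le> blinfun_apply f y - d"
      using separation_point_closed_convex[OF conv clsd] by blast
    have "?h n f \<le> blinfun_apply f y - d"
      using f by (rule cSUP_least[OF ne])
    then show False using y_le[of f n] d by linarith
  qed
  then show ?thesis by blast
qed

section \<open>The sets of weighted ideal limits\<close>

lemma ideal_on_nat_subset: "ideal_on_nat \<I> \<Longrightarrow> A \<in> \<I> \<Longrightarrow> B \<subseteq> A \<Longrightarrow> B \<in> \<I>"
  and ideal_on_nat_Un: "ideal_on_nat \<I> \<Longrightarrow> A \<in> \<I> \<Longrightarrow> B \<in> \<I> \<Longrightarrow> A \<union> B \<in> \<I>"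
  unfolding ideal_on_nat_def by blast+

lemma weighted_ideal_LIM_D:
  "l \<in> weighted_ideal_LIM \<omega> \<I> r x \<Longrightarrow> \<epsilon> > 0 \<Longrightarrow> {t. \<omega> t * norm (x t - l) > r + \<epsilon>} \<in> \<I>"
  by (simp add: weighted_ideal_LIM_def)

lemma weighted_ideal_LIM_mono:
  assumes I: "ideal_on_nat \<I>" and "r \<le> s"
  shows "weighted_ideal_LIM \<omega> \<I> r x \<subseteq> weighted_ideal_LIM \<omega> \<I> s x"
proof
  fix l assume l: "l \<in> weighted_ideal_LIM \<omega> \<I> r x"
  have "{t. \<omega> t * norm (x t - l) > s + \<epsilon>} \<in> \<I>" if "\<epsilon> > 0" for \<epsilon>
    using weighted_ideal_LIM_D[OF l that] assms(2)
    by (rule_tac ideal_on_nat_subset[OF I]) auto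
  then show "l \<in> weighted_ideal_LIM \<omega> \<I> s x" by (simp add: weighted_ideal_LIM_def)
qed

lemma convex_weighted_ideal_LIM:
  assumes I: "ideal_on_nat \<I>" and \<omega>: "\<And>t. 0 \<le> \<omega> t"
  shows "convex (weighted_ideal_LIM \<omega> \<I> r x)"
proof (rule convexI)
  fix a b :: 'a and u v :: real
  assume a: "a \<in> weighted_ideal_LIM \<omega> \<I> r x" and b: "b \<in> weighted_ideal_LIM \<omega> \<I> r x"
    and uv: "0 \<le> u" "0 \<le> v" "u + v = 1"
  have "{t. \<omega> t * norm (x t - (u *\<^sub>R a + v *\<^sub>R b)) > r + \<epsilon>} \<in> \<I>" if "\<epsilon> > 0" for \<epsilon>
  proof (rule ideal_on_nat_subset[OF I])
    show "{t. \<omega> t * norm (x t - a) > r + \<epsilon>} \<union> {t. \<omega> t * norm (x t - b) > r + \<epsilon>} \<in> \<I>"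
      using a b that by (intro ideal_on_nat_Un[OF I] weighted_ideal_LIM_D)
    show "{t. \<omega> t * norm (x t - (u *\<^sub>R a + v *\<^sub>R b)) > r + \<epsilon>} \<subseteq>
        {t. \<omega> t * norm (x t - a) > r + \<epsilon>} \<union> {t. \<omega> t * norm (x t - b) > r + \<epsilon>}"
    proof
      fix t assume t: "t \<in> {t. \<omega> t * norm (x t - (u *\<^sub>R a + v *\<^sub>R b)) > r + \<epsilon>}"
      have "x t - (u *\<^sub>R a + v *\<^sub>R b) = (u + v) *\<^sub>R x t - (u *\<^sub>R a + v *\<^sub>R b)"
        using uv by simp
      also have "\<dots> = u *\<^sub>R (x t - a) + v *\<^sub>R (x t - b)"
        by (simp add: algebra_simps)
      finally have "norm (x t - (u *\<^sub>R a + v *\<^sub>R b)) \<le> u * norm (x t - a) + v * norm (x t - b)"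
        using norm_triangle_ineq[of "u *\<^sub>R (x t - a)" "v *\<^sub>R (x t - b)"] uv by simp
      then have le: "\<omega> t * norm (x t - (u *\<^sub>R a + v *\<^sub>R b)) \<le>
          u * (\<omega> t * norm (x t - a)) + v * (\<omega> t * norm (x t - b))"
        using mult_left_mono[OF _ \<omega>[of t]] by (fastforce simp: algebra_simps)
      show "t \<in> {t. \<omega> t * norm (x t - a) > r + \<epsilon>} \<union> {t. \<omega> t * norm (x t - b) > r + \<epsilon>}"
      proof (rule ccontr)
        assume "\<not> ?thesis"
        then have "\<omega> t * norm (x t - a) \<le> r + \<epsilon>" "\<omega> t * norm (x t - b) \<le> r + \<epsilon>" by auto
        then have "u * (\<omega> t * norm (x t - a)) + v * (\<omega> t * norm (x t - b)) \<le> r + \<epsilon>"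
          using uv by (intro convex_bound_le)
        then show False using le t by simp
      qed
    qed
  qed
  then show "u *\<^sub>R a + v *\<^sub>R b \<in> weighted_ideal_LIM \<omega> \<I> r x"
    by (simp add: weighted_ideal_LIM_def)
qed

text \<open>
  For all \<open>t\<close> outside a set of the ideal, \<open>\<omega> t\<close> times the distance from \<open>x t\<close> to either limit point
  is at most \<open>r + 1\<close>, and some such \<open>t\<close> has weight above \<open>M\<close>. If \<open>M > 0\<close>, this
  bounds the set of limit points; if \<open>M\<close> may be
  taken arbitrarily large, it shows that there is at most one.
\<close>

lemma weighted_ideal_LIM_diff_le:
  assumes I: "ideal_on_nat \<I>" and M: "{t. \<omega> t > M} \<notin> \<I>"
    and a: "a \<in> weighted_ideal_LIM \<omega> \<I> r x" and b: "b \<in> weighted_ideal_LIM \<omega> \<I> r x"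
    and \<omega>: "\<And>t. 0 \<le> \<omega> t"
  shows "M * norm (a - b) \<le> 2 * (r + 1)"
proof -
  let ?U = "{t. \<omega> t * norm (x t - a) > r + 1} \<union> {t. \<omega> t * norm (x t - b) > r + 1}"
  have "?U \<in> \<I>"
    using a b by (intro ideal_on_nat_Un[OF I] weighted_ideal_LIM_D) auto
  then have "\<not> {t. \<omega> t > M} \<subseteq> ?U"
    using ideal_on_nat_subset[OF I] M by blast
  then obtain t where t: "\<omega> t > M" "\<omega> t * norm (x t - a) \<le> r + 1" "\<omega> t * norm (x t - b) \<le> r + 1"
    by (auto simp: subset_iff not_less)
  have "norm (a - b) \<le> norm (x t - a) + norm (x t - b)"
    using norm_triangle_ineq4[of "x t - b" "x t - a"] by simp
  have "M * norm (a - b) \<le> \<omega> t * norm (a - b)"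
    using t by (intro mult_right_mono) auto
  also have "\<dots> \<le> \<omega> t * (norm (x t - a) + norm (x t - b))"
    using \<omega> \<open>norm (a - b) \<le> _\<close> by (intro mult_left_mono)
  also have "\<dots> \<le> 2 * (r + 1)"
    using t by (simp add: algebra_simps)
  finally show ?thesis .
qed

text \<open>
  If the weights are at most \<open>M > 0\<close> outside a set of the ideal, moving \<open>l\<close> by less than
  \<open>\<epsilon> / (2 * M)\<close> changes the weighted distances there by at most \<open>\<epsilon> / 2\<close>. If there is no such \<open>M\<close>,
  the set has at most one element.
\<close>

lemma closed_weighted_ideal_LIM:
  assumes I: "ideal_on_nat \<I>" and \<omega>: "\<And>t. 0 \<le> \<omega> t"
  shows "closed (weighted_ideal_LIM \<omega> \<I> r x)"
proof (cases "\<exists>M. {t. \<omega> t > M} \<in> \<I>")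
  case True
  then obtain M' where M': "{t. \<omega> t > M'} \<in> \<I>" by blast
  define M where "M = max M' 1"
  have M: "{t. \<omega> t > M} \<in> \<I>" "M > 0"
    by (rule ideal_on_nat_subset[OF I M']) (auto simp: M_def)
  have "l \<in> weighted_ideal_LIM \<omega> \<I> r x" if l: "l \<in> closure (weighted_ideal_LIM \<omega> \<I> r x)" for l
  proof -
    have "{t. \<omega> t * norm (x t - l) > r + \<epsilon>} \<in> \<I>" if "\<epsilon> > 0" for \<epsilon>
    proof -
      obtain a where a: "a \<in> weighted_ideal_LIM \<omega> \<I> r x" "norm (a - l) < \<epsilon> / (2 * M)"
        using l M(2) \<open>\<epsilon> > 0\<close> unfolding closure_approachable dist_norm
        by (metis divide_pos_pos mult_pos_pos zero_less_numeral)
      have "{t. \<omega> t > M} \<union> {t. \<omega> t * norm (x t - a) > r + \<epsilon> / 2} \<in> \<I>"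
        using a(1) M(1) \<open>\<epsilon> > 0\<close> by (intro ideal_on_nat_Un[OF I] weighted_ideal_LIM_D) auto
      moreover have "{t. \<omega> t * norm (x t - l) > r + \<epsilon>} \<subseteq>
          {t. \<omega> t > M} \<union> {t. \<omega> t * norm (x t - a) > r + \<epsilon> / 2}"
      proof
        fix t assume t: "t \<in> {t. \<omega> t * norm (x t - l) > r + \<epsilon>}"
        show "t \<in> {t. \<omega> t > M} \<union> {t. \<omega> t * norm (x t - a) > r + \<epsilon> / 2}"
        proof (cases "\<omega> t > M")
          case False
          then have "\<omega> t * norm (a - l) \<le> M * (\<epsilon> / (2 * M))"
            using a(2) M(2) \<omega>[of t] by (intro mult_mono) auto
          then have "\<omega> t * norm (a - l) \<le> \<epsilon> / 2" using M(2) by simp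
          moreover have "\<omega> t * norm (x t - l) \<le> \<omega> t * (norm (x t - a) + norm (a - l))"
            using norm_triangle_ineq[of "x t - a" "a - l"] \<omega>[of t] by (intro mult_left_mono) auto
          ultimately show ?thesis using t by (simp add: distrib_left)
        qed simp
      qed
      ultimately show ?thesis by (rule ideal_on_nat_subset[OF I])
    qed
    then show ?thesis by (simp add: weighted_ideal_LIM_def)
  qed
  then show ?thesis
    by (metis closure_closed closure_subset closed_closure subsetI subset_antisym)
next
  case False
  have "a = b" if ab: "a \<in> weighted_ideal_LIM \<omega> \<I> r x" "b \<in> weighted_ideal_LIM \<omega> \<I> r x" for a b
  proof (rule ccontr)
    assume "a \<noteq> b"
    then have "norm (a - b) > 0" by simp
    \<comment> \<open>the distance of \<open>a\<close> and \<open>b\<close> times this weight exceeds what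
      \<open>weighted_ideal_LIM_diff_le\<close> permits\<close>
    define M where "M = (2 * (r + 1) + 1) / norm (a - b)"
    have "M * norm (a - b) \<le> 2 * (r + 1)"
      using False by (intro weighted_ideal_LIM_diff_le[OF I _ ab \<omega>]) blast
    then show False using \<open>norm (a - b) > 0\<close> by (simp add: M_def)
  qed
  then have "weighted_ideal_LIM \<omega> \<I> r x = {} \<or> (\<exists>a. weighted_ideal_LIM \<omega> \<I> r x = {a})"
    by blast
  then show ?thesis by auto
qed

lemma bounded_weighted_ideal_LIM:
  assumes I: "ideal_on_nat \<I>" and "UNIV \<notin> \<I>" and "\<beta> > 0" and \<beta>: "\<And>t. \<omega> t > \<beta>"
  shows "bounded (weighted_ideal_LIM \<omega> \<I> r x)"
proof (cases "weighted_ideal_LIM \<omega> \<I> r x = {}")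
  case False
  then obtain a where a: "a \<in> weighted_ideal_LIM \<omega> \<I> r x" by blast
  have M: "{t. \<omega> t > \<beta>} \<notin> \<I>" using \<beta> assms(2) by simp
  have "dist a b \<le> 2 * (r + 1) / \<beta>" if "b \<in> weighted_ideal_LIM \<omega> \<I> r x" for b
    using weighted_ideal_LIM_diff_le[OF I M a that] \<beta> \<open>\<beta> > 0\<close>
    by (simp add: dist_norm field_simps less_imp_le order.strict_trans)
  then show ?thesis unfolding bounded_def by blast
qed simp

lemma Inter_weighted_ideal_LIM_subset:
  assumes I: "ideal_on_nat \<I>"
  shows "(\<Inter>n. weighted_ideal_LIM \<omega> \<I> (r + inverse (real (Suc n))) x) \<subseteq> weighted_ideal_LIM \<omega> \<I> r x"
proof
  fix l assume l: "l \<in> (\<Inter>n. weighted_ideal_LIM \<omega> \<I> (r + inverse (real (Suc n))) x)"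
  have "{t. \<omega> t * norm (x t - l) > r + \<epsilon>} \<in> \<I>" if "\<epsilon> > 0" for \<epsilon>
  proof -
    obtain n where n: "inverse (real (Suc n)) < \<epsilon> / 2"
      using reals_Archimedean[of "\<epsilon> / 2"] \<open>\<epsilon> > 0\<close> by auto
    have "{t. \<omega> t * norm (x t - l) > r + inverse (real (Suc n)) + \<epsilon> / 2} \<in> \<I>"
      using l \<open>\<epsilon> > 0\<close> by (intro weighted_ideal_LIM_D) auto
    then show ?thesis
      by (rule ideal_on_nat_subset[OF I]) (use n in auto)
  qed
  then show "l \<in> weighted_ideal_LIM \<omega> \<I> r x" by (simp add: weighted_ideal_LIM_def)
qed

lemma weighted_ideal_LIM_nonempty_above_degree:
  assumes I: "ideal_on_nat \<I>" and "min_weighted_ideal_degree \<omega> \<I> x < ereal s"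
  shows "weighted_ideal_LIM \<omega> \<I> s x \<noteq> {}"
proof -
  obtain s' where "s' < s" "weighted_ideal_LIM \<omega> \<I> s' x \<noteq> {}"
    using assms(2) unfolding min_weighted_ideal_degree_def Inf_less_iff by auto
  then show ?thesis using weighted_ideal_LIM_mono[OF I, of s' s \<omega> x] by auto
qed

theorem theorem3p6:
  fixes \<omega> :: "nat \<Rightarrow> real" and \<I> :: "nat set set"
    and x :: "nat \<Rightarrow> 'a::real_normed_vector"
  assumes "reflexive_space TYPE('a)"
    and "ideal_on_nat \<I>"
    and "weighted_sequence \<omega>"
    and "min_weighted_ideal_degree \<omega> \<I> x < \<infinity>"
  shows "weighted_ideal_LIM \<omega> \<I> (real_of_ereal (min_weighted_ideal_degree \<omega> \<I> x)) x \<noteq> {}"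
proof (cases "UNIV \<in> \<I>")
  case True
  then have "A \<in> \<I>" for A
    using ideal_on_nat_subset[OF assms(2)] by blast
  then show ?thesis by (simp add: weighted_ideal_LIM_def)
next
  case False
  obtain \<beta> where \<beta>: "\<beta> > 0" "\<And>t. \<omega> t > \<beta>"
    using assms(3) by (auto simp: weighted_sequence_def)
  then have \<omega>: "0 \<le> \<omega> t" for t
    by (meson less_imp_le order.strict_trans)
  define r where "r = real_of_ereal (min_weighted_ideal_degree \<omega> \<I> x)"
  have r: "min_weighted_ideal_degree \<omega> \<I> x = ereal r"
    using assms(4) min_weighted_ideal_degree_nonneg[of \<omega> \<I> x]
    by (cases "min_weighted_ideal_degree \<omega> \<I> x") (auto simp: r_def)
  let ?C = "\<lambda>n. weighted_ideal_LIM \<omega> \<I> (r + inverse (real (Suc n))) x"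
  have "(\<Inter>n. ?C n) \<noteq> {}"
  proof (rule reflexive_nested_convex_nonempty[OF assms(1)])
    show "?C n \<noteq> {}" for n
      by (rule weighted_ideal_LIM_nonempty_above_degree[OF assms(2)]) (simp add: r)
    show "decseq ?C"
      unfolding decseq_def
      by (intro allI impI weighted_ideal_LIM_mono[OF assms(2)]) (simp add: le_imp_inverse_le)
    show "bounded (?C 0)"
      using assms(2) False \<beta> by (rule bounded_weighted_ideal_LIM)
    show "convex (?C n)" for n
      using assms(2) \<omega> by (rule convex_weighted_ideal_LIM)
    show "closed (?C n)" for n
      using assms(2) \<omega> by (rule closed_weighted_ideal_LIM)
  qed
  then show ?thesis
    using Inter_weighted_ideal_LIM_subset[OF assms(2), of \<omega> r x] by (auto simp: r_def)
qed

end
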